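(* Let $\alpha$ be an umbra and let $\varphi_\alpha$ be an $\alpha$-factorial umbra. Then $$\varphi_\alpha^n\simeq(\alpha)_n,\qquad n=0,1,2,\ldots,$$ where $(\alpha)_0=1$ and $(\alpha)_n=\alpha(\alpha-1)\cdots(\alpha-n+1)$ is the lower factorial.
   Context: Umbral calculus: $R$ is a commutative integral domain whose quotient field has characteristic zero; $A$ is a set (alphabet) whose elements are called umbrae; $E:R[A]\to R$ is a linear functional (evaluation) with $E[1]=1$ and $E[\alpha^i\gamma^j\cdots\delta^k]=E[\alpha^i]E[\gamma^j]\cdots E[\delta^k]$ for distinct umbrae and nonnegative integers $i,j,\dots,k$. The moments of $\alpha$ are $a_n=E[\alpha^n]$; its generating function (g.f.) is the formal power series $f(t)=1+\sum_{n\ge1}a_n t^n/n!$. For $p,q\in R[A]$, $p\simeq q$ means $E[p]=E[q]$; two umbrae are similar, $\alpha\equiv\gamma$, if $\alpha^n\simeq\gamma^n$ for all $n\ge0$. The alphabet is assumed saturated, i.e. it contains sufficiently many distinct umbrae similar to any expression considered, so that the auxiliary umbrae below exist as umbrae; they are defined up to similarity by their g.f. Dot-product: if $\alpha$ has g.f. $f(t)$ and $\gamma$ has g.f. $g(t)$, then $\gamma.\alpha$ is an auxiliary umbra with g.f. $g[\log f(t)]$. Singleton umbra $\chi$: $E[\chi^n]=\delta_{1,n}$ for $n\ge1$; its g.f. is $1+t$. Factorial umbra: an umbra $\varphi_\alpha$ is an $\alpha$-factorial umbra if $\varphi_\alpha\equiv\alpha.\chi$. *)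

theory Defs
  imports
    "HOL-Library.Poly_Mapping"
    "HOL-Computational_Algebra.Fraction_Field"
    "HOL-Computational_Algebra.Formal_Power_Series"
begin

text \<open>
  The ring \<open>R\<close> is a type of sort \<open>{idom, ring_char_0}\<close>; an integral domain has
  characteristic zero iff its quotient field does.  The alphabet \<open>A\<close> is a type, and
  \<open>R[A]\<close> consists of the finitely supported maps from monomials (finitely supported
  exponent vectors over \<open>A\<close>) to \<open>R\<close>, with the convolution product of
  \<^theory>\<open>HOL-Library.Poly_Mapping\<close>.
\<close>

type_synonym ('a, 'r) umbral_poly = "('a \<Rightarrow>\<^sub>0 nat) \<Rightarrow>\<^sub>0 'r"

instance fract :: ("{idom, ring_char_0}") field_char_0
proof
  show "inj (of_nat :: nat \<Rightarrow> 'a fract)"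
  proof (rule injI)
    fix m n :: nat
    assume "(of_nat m :: 'a fract) = of_nat n"
    then have "Fraction_Field.Fract (of_nat m :: 'a) 1 = Fraction_Field.Fract (of_nat n) 1"
      by (simp add: Fraction_Field.of_nat_fract)
    then show "m = n"
      by (simp add: Fraction_Field.eq_fract(1))
  qed
qed

definition umbra :: "'a \<Rightarrow> ('a, 'r::{idom, ring_char_0}) umbral_poly" where
  "umbra \<alpha> = Poly_Mapping.single (Poly_Mapping.single \<alpha> 1) 1"

definition const_poly :: "'r \<Rightarrow> ('a, 'r::{idom, ring_char_0}) umbral_poly" where
  "const_poly c = Poly_Mapping.single 0 c"

locale umbral_calculus =
  fixes E :: "('a, 'r::{idom, ring_char_0}) umbral_poly \<Rightarrow> 'r"
  assumes E_add: "E (p + q) = E p + E q"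
    and E_scale: "E (const_poly c * p) = c * E p"
    and E_one: "E 1 = 1"
    and E_uncorrelated:
      "finite S \<Longrightarrow> E (\<Prod>\<alpha>\<in>S. umbra \<alpha> ^ k \<alpha>) = (\<Prod>\<alpha>\<in>S. E (umbra \<alpha> ^ k \<alpha>))"

definition moment :: "(('a, 'r::{idom, ring_char_0}) umbral_poly \<Rightarrow> 'r) \<Rightarrow> 'a \<Rightarrow> nat \<Rightarrow> 'r" where
  "moment E \<alpha> n = E (umbra \<alpha> ^ n)"

definition umbral_eq ::
  "(('a, 'r::{idom, ring_char_0}) umbral_poly \<Rightarrow> 'r) \<Rightarrow>
    ('a, 'r) umbral_poly \<Rightarrow> ('a, 'r) umbral_poly \<Rightarrow> bool" where
  "umbral_eq E p q \<longleftrightarrow> E p = E q"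

definition similar ::
  "(('a, 'r::{idom, ring_char_0}) umbral_poly \<Rightarrow> 'r) \<Rightarrow> 'a \<Rightarrow> 'a \<Rightarrow> bool" where
  "similar E \<alpha> \<gamma> \<longleftrightarrow> (\<forall>n. umbral_eq E (umbra \<alpha> ^ n) (umbra \<gamma> ^ n))"

definition gen_fun ::
  "(('a, 'r::{idom, ring_char_0}) umbral_poly \<Rightarrow> 'r) \<Rightarrow> 'a \<Rightarrow> 'r fract fps" where
  "gen_fun E \<alpha> =
    1 + Abs_fps (\<lambda>n. if n = 0 then 0 else Fraction_Field.Fract (moment E \<alpha> n) 1 / fact n)"

text \<open>
  \<^term>\<open>fps_ln 1\<close> is the expansion of \<open>log (1 + t)\<close>, so this is the logarithm of a series
  with constant term \<open>1\<close>.
\<close>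

definition fps_log :: "'k::field_char_0 fps \<Rightarrow> 'k fps" where
  "fps_log f = fps_ln 1 oo (f - 1)"

text \<open>
  Auxiliary umbrae are only determined up to similarity, so they are introduced as
  relations: \<open>is_dot_product E \<gamma> \<alpha> \<delta>\<close> means that \<open>\<delta>\<close> is an umbra \<open>\<gamma>.\<alpha>\<close>.
\<close>

definition is_dot_product ::
  "(('a, 'r::{idom, ring_char_0}) umbral_poly \<Rightarrow> 'r) \<Rightarrow> 'a \<Rightarrow> 'a \<Rightarrow> 'a \<Rightarrow> bool" where
  "is_dot_product E \<gamma> \<alpha> \<delta> \<longleftrightarrow> gen_fun E \<delta> = gen_fun E \<gamma> oo fps_log (gen_fun E \<alpha>)"

definition is_singleton_umbra ::
  "(('a, 'r::{idom, ring_char_0}) umbral_poly \<Rightarrow> 'r) \<Rightarrow> 'a \<Rightarrow> bool" where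
  "is_singleton_umbra E \<chi> \<longleftrightarrow> (\<forall>n\<ge>1. moment E \<chi> n = (if n = 1 then 1 else 0))"

definition is_factorial_umbra ::
  "(('a, 'r::{idom, ring_char_0}) umbral_poly \<Rightarrow> 'r) \<Rightarrow> 'a \<Rightarrow> 'a \<Rightarrow> bool" where
  "is_factorial_umbra E \<alpha> \<phi> \<longleftrightarrow>
    (\<exists>\<chi> \<delta>. is_singleton_umbra E \<chi> \<and> is_dot_product E \<alpha> \<chi> \<delta> \<and> similar E \<phi> \<delta>)"

text \<open>
  Saturation: every polynomial has infinitely many umbrae similar to it, and the
  auxiliary umbrae exist; by the first condition they then exist in infinitely many
  distinct copies.
\<close>

locale saturated_umbral_calculus = umbral_calculus E
  for E :: "('a, 'r::{idom, ring_char_0}) umbral_poly \<Rightarrow> 'r" +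
  assumes infinite_similar: "infinite {\<gamma>. \<forall>n. umbral_eq E (umbra \<gamma> ^ n) (p ^ n)}"
    and singleton_exists: "\<exists>\<chi>. is_singleton_umbra E \<chi>"
    and dot_product_exists: "\<exists>\<delta>. is_dot_product E \<gamma> \<alpha> \<delta>"

definition lower_factorial :: "'b::comm_ring_1 \<Rightarrow> nat \<Rightarrow> 'b" where
  "lower_factorial x n = (\<Prod>i<n. x - of_nat i)"

end

theory Submission
  imports
    Defs
    "HOL-Combinatorics.Stirling"
    "HOL-Computational_Algebra.Polynomial_Factorial"
begin

text \<open>
  The generating function of \<open>\<alpha>.\<chi>\<close> is \<open>f(log (1 + t))\<close>, so its \<open>n\<close>-th moment is
  \<open>\<Sum>k. a\<^sub>k n!/k! [t\<^sup>n] (log (1 + t))\<^sup>k\<close>.  The numbers \<open>n!/k! [t\<^sup>n] (log (1 + t))\<^sup>k\<close>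
  are the signed Stirling numbers of the first kind, which are also the coefficients of
  the powers of \<open>x\<close> in the lower factorial \<open>(x)\<^sub>n\<close>.
\<close>

unbundle fps_syntax

text \<open>Pulling a sign out of each factor leaves the rising factorial of \<open>- x\<close>,
  whose coefficients are the unsigned Stirling numbers.\<close>

lemma lower_factorial_stirling:
  fixes x :: "'b::comm_ring_1"
  shows "lower_factorial x n = (\<Sum>k\<le>n. of_int ((-1) ^ (n + k) * int (stirling n k)) * x ^ k)"
proof -
  have "lower_factorial x n = (-1) ^ n * pochhammer (- x) n"
    by (induction n) (auto simp: lower_factorial_def pochhammer_Suc algebra_simps)
  also have "pochhammer (- x) n = (\<Sum>k\<le>n. of_nat (stirling n k) * (- x) ^ k)"
    by (rule stirling_pochhammer[symmetric])
  also have "(-1) ^ n * \<dots> = (\<Sum>k\<le>n. of_int ((-1) ^ (n + k) * int (stirling n k)) * x ^ k)"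
    by (simp add: sum_distrib_left power_minus[of x] power_add mult_ac)
  finally show ?thesis .
qed

text \<open>The exponential generating function of column \<open>k\<close> of the signed Stirling
  numbers, cleared of denominators. The induction keeps \<open>k\<close> general because each step
  also uses column \<open>k - 1\<close>.\<close>

lemma fps_ln_power_nth:
  "fact n * (fps_ln (1::'k::field_char_0) ^ k) $ n =
    fact k * of_int ((-1) ^ (n + k) * int (stirling n k))"
proof (induction n arbitrary: k)
  case 0
  then show ?case by (cases k) (simp_all add: fps_ln_def fps_nth_power_0)
next
  case IH: (Suc n)
  show ?case
  proof (cases k)
    case 0
    then show ?thesis by simp
  next
    case (Suc j)
    let ?L = "fps_ln (1::'k)"
    txt \<open>The coefficients of \<open>(1 + t) (L\<^sup>k)' = k L\<^sup>k\<^sup>-\<^sup>1\<close> satisfy the Stirling recurrence.\<close>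
    have "(1 + fps_X) * fps_deriv (?L ^ k) = of_nat k * ?L ^ j * ((1 + fps_X) * fps_deriv ?L)"
      by (simp only: fps_deriv_power' Suc diff_Suc_1 mult_ac)
    also have "(1 + fps_X) * fps_deriv ?L = 1"
      by (simp add: fps_ln_deriv inverse_mult_eq_1')
    finally have "((1 + fps_X) * fps_deriv (?L ^ k)) $ n = (of_nat k * ?L ^ j) $ n"
      by simp
    then have "of_nat (Suc n) * (?L ^ k) $ Suc n + of_nat n * (?L ^ k) $ n = of_nat k * (?L ^ j) $ n"
      \<comment> \<open>\<open>fps_X\<close> shifts coefficients by one, so \<open>n = 0\<close> is
        treated apart.\<close>
      by (cases n) (simp_all add: distrib_right flip: fps_of_nat)
    then have "of_nat (Suc n) * (?L ^ k) $ Suc n = of_nat k * (?L ^ j) $ n - of_nat n * (?L ^ k) $ n"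
      by (simp add: eq_diff_eq)
    moreover have "fact (Suc n) * (?L ^ k) $ Suc n = fact n * (of_nat (Suc n) * (?L ^ k) $ Suc n)"
      by (simp add: mult_ac)
    ultimately have "fact (Suc n) * (?L ^ k) $ Suc n
        = of_nat k * (fact n * (?L ^ j) $ n) - of_nat n * (fact n * (?L ^ k) $ n)"
      by (simp only:) (simp add: algebra_simps)
    also have "\<dots> = fact k * of_int ((-1) ^ (Suc n + k) * int (stirling (Suc n) k))"
      unfolding IH using Suc by (simp add: algebra_simps)
    finally show ?thesis .
  qed
qed

lemma to_fract_of_int: "to_fract (of_int z) = (of_int z :: 'b::idom fract)"
proof -
  have "to_fract (of_nat m) = (of_nat m :: 'b::idom fract)" for m
    by (simp add: to_fract_def Fraction_Field.of_nat_fract)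
  then show ?thesis
    by (cases z rule: int_diff_cases) simp
qed

lemma to_fract_sum: "to_fract (\<Sum>x\<in>A. f x) = (\<Sum>x\<in>A. to_fract (f x))"
  by (induction A rule: infinite_finite_induct) simp_all

context umbral_calculus
begin

sublocale Modules.additive E
  by standard (rule E_add)

lemma E_of_int_mult: "E (of_int z * p) = of_int z * E p"
proof -
  have "E (of_nat m * p) = of_nat m * E p" for m
    by (induction m) (simp_all add: zero add algebra_simps)
  then show ?thesis
    by (cases z rule: int_diff_cases) (simp add: diff left_diff_distrib)
qed

lemma E_lower_factorial:
  "E (lower_factorial (umbra \<alpha>) n) =
    (\<Sum>k\<le>n. of_int ((-1) ^ (n + k) * int (stirling n k)) * moment E \<alpha> k)"
  unfolding lower_factorial_stirling sum E_of_int_mult moment_def ..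

text \<open>By \<open>E_one\<close> the zeroth moment is 1, so the constant term, set apart in
  \<open>gen_fun\<close>, obeys the same formula.\<close>

lemma gen_fun_nth: "gen_fun E \<alpha> $ n = to_fract (moment E \<alpha> n) / fact n"
  by (simp add: gen_fun_def moment_def E_one flip: to_fract_def)

lemma gen_fun_singleton:
  assumes "is_singleton_umbra E \<chi>"
  shows "gen_fun E \<chi> = 1 + fps_X"
proof (rule fps_ext)
  fix n
  have "moment E \<chi> n = (if n \<le> 1 then 1 else 0)"
    using assms by (cases "n = 0") (auto simp: is_singleton_umbra_def moment_def E_one)
  then show "gen_fun E \<chi> $ n = (1 + fps_X) $ n"
    by (auto simp: gen_fun_nth fps_X_def le_Suc_eq)
qed

lemma moment_dot_product_singleton:
  assumes "is_singleton_umbra E \<chi>" and "is_dot_product E \<alpha> \<chi> \<delta>"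
  shows "moment E \<delta> n = E (lower_factorial (umbra \<alpha>) n)"
proof -
  \<comment> \<open>Here \<open>gen_fun E \<chi> - 1\<close> is \<open>fps_X\<close>, so the
    logarithm is \<open>fps_ln 1\<close> itself.\<close>
  have "gen_fun E \<delta> = gen_fun E \<alpha> oo fps_ln 1"
    using assms by (simp add: is_dot_product_def gen_fun_singleton fps_log_def)
  then have "to_fract (moment E \<delta> n) = fact n * (gen_fun E \<alpha> oo fps_ln 1) $ n"
    using gen_fun_nth[of \<delta> n] by simp
  also have "\<dots> = (\<Sum>k\<le>n. gen_fun E \<alpha> $ k * (fact n * (fps_ln 1 ^ k) $ n))"
    by (simp add: fps_compose_nth sum_distrib_left mult_ac atMost_atLeast0)
  \<comment> \<open>The factor \<open>fact k\<close> cancels the denominator of the moment, so every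
    summand comes from the ring.\<close>
  also have "\<dots> = (\<Sum>k\<le>n. to_fract (of_int ((-1) ^ (n + k) * int (stirling n k)) * moment E \<alpha> k))"
    unfolding fps_ln_power_nth gen_fun_nth to_fract_mult to_fract_of_int
    by (intro sum.cong) simp_all
  \<comment> \<open>Injectivity of \<open>to_fract\<close> brings the identity back from the
    quotient field.\<close>
  finally show ?thesis
    by (simp only: E_lower_factorial to_fract_eq_iff flip: to_fract_sum)
qed

end

theorem proposition5p7:
  fixes E :: "('a, 'r::{idom, ring_char_0}) umbral_poly \<Rightarrow> 'r"
    and \<alpha> \<phi> :: 'a and n :: nat
  assumes "saturated_umbral_calculus E"
    and "is_factorial_umbra E \<alpha> \<phi>"
  shows "umbral_eq E (umbra \<phi> ^ n) (lower_factorial (umbra \<alpha>) n)"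
proof -
  interpret saturated_umbral_calculus E by fact
  show ?thesis
    using assms(2) moment_dot_product_singleton
    by (auto simp: is_factorial_umbra_def similar_def umbral_eq_def moment_def)
qed

end
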